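(* Let $X := \mathcal{C}([0,+\infty)) \cap L^1([0,+\infty))$ with the metric $$d_X(f,g) := \|f-g\|_{L^1} + \sum_{n=1}^{\infty} \frac{1}{2^n}\cdot \frac{\|f-g\|_{\infty,n}}{1+\|f-g\|_{\infty,n}},\qquad \|f\|_{\infty,n} = \max\{|f(x)| : x\in[0,n]\},$$ let $\mathcal{A} = \{ f \in X : \limsup_{x \to +\infty} |f(x)| = +\infty \}$, and let $$\mathcal{A}_0 := \{(f_n)_n : f_n \in \mathcal{A} \text{ for all } n\in\mathbb{N} \text{ and } d_X(f_n,0)\to 0 \text{ as } n\to\infty\}.$$ Then $\mathcal{A}_0$ is strongly algebrable; that is, there is an infinitely generated free (commutative) subalgebra $M$ of the algebra $\mathcal{C}([0,+\infty))^{\mathbb{N}}$ of sequences of continuous functions (with componentwise pointwise operations) such that $M\setminus\{0\}\subset\mathcal{A}_0$.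
   Context: $\mathcal{C}([0,+\infty))$ is the real algebra of all continuous functions $[0,+\infty)\to\mathbb{R}$ with pointwise operations, and $L^1([0,+\infty))$ is the space of Lebesgue integrable functions on $[0,+\infty)$ with $\|f\|_{L^1}=\int_0^\infty |f(x)|\,dx$. Subalgebras are not required to contain a unit. A subset $A$ of a commutative algebra is algebrable if there is an algebra $M$ with $M\setminus\{0\}\subset A$ that is infinitely generated (every system of generators of $M$ is infinite), and strongly algebrable if moreover $M$ can be taken free. Equivalently (in the commutative case), there is an infinite set $B$ generating the algebra $M$ such that for every $s\in\mathbb{N}$, every nonzero polynomial $P$ in $s$ variables without constant term and all distinct $f_1,\dots,f_s\in B$, one has $P(f_1,\dots,f_s)\in M\setminus\{0\}$, and $M\setminus\{0\}\subset A$. *)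

theory Defs
  imports "HOL-Analysis.Analysis" "HOL-Library.Function_Algebras" "HOL-Library.Poly_Mapping"
begin

section \<open>Pointwise scalar multiplication\<close>

text \<open>\<open>HOL-Library.Function_Algebras\<close> makes function spaces (commutative) rings with the pointwise
  operations. The scalar action completes them to real algebras, so that sequences of real functions,
  \<^typ>\<open>nat \<Rightarrow> real \<Rightarrow> real\<close>, carry the componentwise pointwise algebra structure.\<close>

instantiation "fun" :: (type, scaleR) scaleR
begin

definition scaleR_fun_def: "c *\<^sub>R f = (\<lambda>x. c *\<^sub>R f x)"

instance ..

end

lemma scaleR_fun_apply [simp]: "(c *\<^sub>R f) x = c *\<^sub>R f x"
  by (simp add: scaleR_fun_def)

instance "fun" :: (type, real_vector) real_vector
  by standard (simp_all add: fun_eq_iff scaleR_add_right scaleR_add_left)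

instance "fun" :: (type, real_algebra) real_algebra
  by standard (simp_all add: fun_eq_iff)

instance "fun" :: (type, real_algebra_1) real_algebra_1 ..


section \<open>Strong algebrability\<close>

text \<open>Subalgebras need not contain the unit of the surrounding algebra.\<close>

definition subalg :: "'a::real_algebra set \<Rightarrow> bool" where
  "subalg M \<longleftrightarrow> subspace M \<and> (\<forall>x\<in>M. \<forall>y\<in>M. x * y \<in> M)"

lemma subalg_hull: "subalg (subalg hull B)"
  by (rule hull_in) (auto simp: subalg_def subspace_def)

definition infinitely_generated :: "'a::real_algebra set \<Rightarrow> bool" where
  "infinitely_generated M \<longleftrightarrow> (\<forall>G. subalg hull G = M \<longrightarrow> infinite G)"

text \<open>A real polynomial in the variables \<open>X\<^sub>0, X\<^sub>1, \<dots>\<close> is a finitely supported family of coefficients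
  indexed by monomials, a monomial being a finitely supported family of exponents.\<close>

type_synonym real_mpoly = "(nat \<Rightarrow>\<^sub>0 nat) \<Rightarrow>\<^sub>0 real"

definition in_vars :: "nat \<Rightarrow> real_mpoly \<Rightarrow> bool" where
  "in_vars s P \<longleftrightarrow> (\<forall>m\<in>Poly_Mapping.keys P. Poly_Mapping.keys m \<subseteq> {..<s})"

definition no_const_term :: "real_mpoly \<Rightarrow> bool" where
  "no_const_term P \<longleftrightarrow> Poly_Mapping.lookup P 0 = 0"

definition poly_eval :: "real_mpoly \<Rightarrow> (nat \<Rightarrow> 'a) \<Rightarrow> 'a::{real_algebra_1, comm_ring_1}" where
  "poly_eval P f = (\<Sum>m\<in>Poly_Mapping.keys P. Poly_Mapping.lookup P m *\<^sub>R
     (\<Prod>i\<in>Poly_Mapping.keys m. f i ^ Poly_Mapping.lookup m i))"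

text \<open>\<open>B\<close> freely generates \<open>M\<close> as a commutative, not necessarily unital algebra. The free such
  algebra on \<open>B\<close> consists of the polynomials in \<open>B\<close> without constant term. The unit of the type
  occurs in \<^const>\<open>poly_eval\<close> only through the (excluded) constant term.\<close>

definition free_generators :: "'a::{real_algebra_1, comm_ring_1} set \<Rightarrow> 'a set \<Rightarrow> bool" where
  "free_generators B M \<longleftrightarrow> subalg hull B = M \<and>
     (\<forall>s P f. P \<noteq> 0 \<longrightarrow> in_vars s P \<longrightarrow> no_const_term P \<longrightarrow>
        inj_on f {..<s} \<longrightarrow> f ` {..<s} \<subseteq> B \<longrightarrow> poly_eval P f \<noteq> 0)"

definition free_subalg :: "'a::{real_algebra_1, comm_ring_1} set \<Rightarrow> bool" where
  "free_subalg M \<longleftrightarrow> (\<exists>B. free_generators B M)"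

text \<open>\<open>E\<close> is the surrounding algebra.\<close>

definition strongly_algebrable_in :: "'a::{real_algebra_1, comm_ring_1} set \<Rightarrow> 'a set \<Rightarrow> bool" where
  "strongly_algebrable_in E A \<longleftrightarrow>
     (\<exists>M. M \<subseteq> E \<and> subalg M \<and> infinitely_generated M \<and> free_subalg M \<and> M - {0} \<subseteq> A)"


section \<open>The function spaces\<close>

text \<open>A function on \<open>[0,\<infinity>)\<close> is represented by its extension by zero to \<open>\<real>\<close>, so that equality
  (in particular with \<open>0\<close>) is equality on \<open>[0,\<infinity>)\<close>. The extension need not be continuous at \<open>0\<close>.\<close>

definition C_half :: "(real \<Rightarrow> real) set" where
  "C_half = {f. continuous_on {0..} f \<and> (\<forall>x<0. f x = 0)}"

definition C_half_seq :: "(nat \<Rightarrow> real \<Rightarrow> real) set" where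
  "C_half_seq = {F. \<forall>n. F n \<in> C_half}"

lemma subalg_C_half: "subalg C_half"
  unfolding subalg_def subspace_def C_half_def
  by (auto simp: plus_fun_def times_fun_def scaleR_fun_def zero_fun_def intro!: continuous_intros)

lemma subalg_C_half_seq: "subalg C_half_seq"
  using subalg_C_half by (auto simp: subalg_def subspace_def C_half_seq_def)

definition X_space :: "(real \<Rightarrow> real) set" where
  "X_space = {f \<in> C_half. set_integrable lborel {0..} f}"

definition L1_norm :: "(real \<Rightarrow> real) \<Rightarrow> real" where
  "L1_norm f = (LINT x:{0..}|lborel. \<bar>f x\<bar>)"

text \<open>For continuous \<open>f\<close> the supremum is attained.\<close>

definition sup_norm :: "nat \<Rightarrow> (real \<Rightarrow> real) \<Rightarrow> real" where
  "sup_norm n f = (SUP x\<in>{0..real n}. \<bar>f x\<bar>)"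

text \<open>The series over \<open>n \<ge> 1\<close> is shifted to start at \<open>0\<close>.\<close>

definition d_X :: "(real \<Rightarrow> real) \<Rightarrow> (real \<Rightarrow> real) \<Rightarrow> real" where
  "d_X f g = L1_norm (f - g) +
     suminf (\<lambda>n. 1 / 2 ^ Suc n * (sup_norm (Suc n) (f - g) / (1 + sup_norm (Suc n) (f - g))))"

definition A_set :: "(real \<Rightarrow> real) set" where
  "A_set = {f \<in> X_space. Limsup at_top (\<lambda>x. ereal \<bar>f x\<bar>) = \<infinity>}"

definition A_0 :: "(nat \<Rightarrow> real \<Rightarrow> real) set" where
  "A_0 = {F. (\<forall>n. F n \<in> A_set) \<and> (\<lambda>n. d_X (F n) 0) \<longlonglongrightarrow> 0}"

end

theory Submission
  imports Defs "HOL-Real_Asymp.Real_Asymp"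
begin

text \<open>Fix a continuous function \<open>w\<close> on \<open>[0,\<infinity>)\<close> with \<open>0 \<le> w \<le> 1\<close> that equals \<open>1\<close> at every integer
  and lives on spikes around the integers that are so thin that \<open>b\<^sup>x w(x)\<close> is integrable for every
  \<open>b\<close>. Let \<open>w\<^sub>n\<close> be \<open>w\<close> cut off continuously to \<open>[n,\<infinity>)\<close>. The free generators are the sequences
  \<open>g\<^sub>p = (p\<^sup>x w\<^sub>n(x))\<^sub>n\<close> for the primes \<open>p\<close>.

  A product of generators is \<open>g\<^sub>N = (N\<^sup>x w\<^sub>n(x)\<^bsup>\<Omega>(N)\<^esup>)\<^sub>n\<close>, where \<open>N \<ge> 2\<close> is the product of the primes
  used and \<open>\<Omega>(N)\<close> their number. By unique factorization distinct monomials in the generators give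
  distinct \<open>N\<close>, so the algebra that they generate is the linear span of the \<open>g\<^sub>N\<close> with \<open>N \<ge> 2\<close>, and
  everything reduces to finite linear combinations \<open>F = \<Sum> c\<^sub>N g\<^sub>N\<close> (\<open>spike_combination_in_A_0\<close>):

  \<^item> At the integers \<open>k > n\<close> the \<open>n\<close>-th term of \<open>F\<close> has the value \<open>\<Sum> c\<^sub>N N\<^sup>k\<close>. Unless all
    coefficients vanish, the largest \<open>N\<close> with \<open>c\<^sub>N \<noteq> 0\<close> dominates, and since \<open>N \<ge> 2\<close> the absolute
    values tend to infinity (\<open>exponential_sum_unbounded\<close>).
  \<^item> All terms of \<open>F\<close> are dominated by the integrable function \<open>\<Sum> |c\<^sub>N| N\<^sup>x w(x)\<close>, and the \<open>n\<close>-th one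
    vanishes on \<open>[0,n]\<close>. Hence the \<open>L\<^sup>1\<close> norms tend to \<open>0\<close> by dominated convergence, and so does the
    series in the metric by dominated convergence for series (\<open>d_X_tendsto_0\<close>).

  So every combination with a nonzero coefficient lies in \<^const>\<open>A_0\<close>. As \<open>0\<close> does not, the \<open>g\<^sub>N\<close> are
  linearly independent, and this is the freeness of the generators. The algebra is infinitely
  generated because finitely many elements involve finitely many primes, and they generate only
  combinations of the \<open>g\<^sub>N\<close> with \<open>N\<close> composed of these primes.\<close>


section \<open>A train of integrable spikes\<close>

text \<open>The factor \<open>exp ((x + 1)\<^sup>2)\<close> makes the spikes thin. Since \<open>x + 1 \<ge> k\<close> holds on
  all of the spike at \<open>k\<close>, the shift by \<open>1\<close> confines this spike to \<open>|x - k| \<le> exp (- k\<^sup>2)\<close>.\<close>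

definition spikes :: "real \<Rightarrow> real" where
  "spikes x = max 0 (1 - exp ((x + 1)\<^sup>2) * infdist x \<int>)"

lemma spikes_nonneg: "0 \<le> spikes x"
  by (simp add: spikes_def)

lemma spikes_le_1: "spikes x \<le> 1"
  by (simp add: spikes_def infdist_nonneg)

lemma spikes_of_nat: "spikes (real k) = 1"
  by (simp add: spikes_def infdist_zero)

lemma continuous_on_spikes: "continuous_on A spikes"
  unfolding spikes_def by (intro continuous_intros)

lemma spikes_support:
  assumes "0 \<le> x" "spikes x \<noteq> 0"
  obtains k :: nat where "\<bar>x - real k\<bar> \<le> exp (- (real k)\<^sup>2)" "x \<le> real k + 1"
proof -
  define e where "e = exp (- (x + 1)\<^sup>2)"
  have e: "e \<le> 1" by (simp add: e_def)
  from assms(2) have "exp ((x + 1)\<^sup>2) * infdist x \<int> < 1"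
    by (simp add: spikes_def max_def split: if_splits)
  then have "infdist x \<int> < e"
    by (simp add: e_def exp_minus field_simps)
  moreover have "infdist x \<int> = (INF a\<in>\<int>. dist x a)"
    by (auto simp: infdist_def)
  ultimately obtain a :: real where a: "a \<in> \<int>" "dist x a < e"
    by (metis (no_types, lifting) Ints_0 bdd_below_image_dist cINF_less_iff empty_iff)
  from a(1) obtain i where i: "a = of_int i" by (auto elim: Ints_cases)
  have d: "\<bar>x - of_int i\<bar> < e" using a i by (simp add: dist_real_def)
  with e assms(1) have "of_int i > (-1::real)" by linarith
  then have "i \<ge> 0" by linarith
  then obtain k where k: "i = int k" by (metis nonneg_int_cases)
  have d': "\<bar>x - real k\<bar> < e" using d k by simp
  with e have "real k \<le> x + 1" "x \<le> real k + 1" by linarith+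
  then have "(real k)\<^sup>2 \<le> (x + 1)\<^sup>2" by (intro power_mono) auto
  then have "e \<le> exp (- (real k)\<^sup>2)" by (simp add: e_def)
  with d' \<open>x \<le> real k + 1\<close> show ?thesis by (intro that[of k]) auto
qed

text \<open>The areas of rectangles that contain the spikes of \<open>b\<^sup>x\<close> times the train: the width
  \<open>2 exp (- k\<^sup>2)\<close> beats every exponential height.\<close>

lemma summable_spike_areas:
  fixes b :: real
  assumes "1 < b"
  shows "summable (\<lambda>k. b powr (real k + 1) * (2 * exp (- (real k)\<^sup>2)))"
proof (rule summable_comparison_test_bigo)
  show "summable (\<lambda>k. norm ((1 / 2) ^ k :: real))" by simp
  show "(\<lambda>k. b powr (real k + 1) * (2 * exp (- (real k)\<^sup>2))) \<in> O(\<lambda>k. (1 / 2) ^ k)"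
    using assms by real_asymp
qed

lemma powr_spikes_integrable:
  fixes b :: real
  assumes b: "1 < b"
  shows "set_integrable lborel {0..} (\<lambda>x. b powr x * spikes x)"
  unfolding set_integrable_def
proof (rule integrableI_bounded)
  let ?I = "\<lambda>k::nat. {real k - exp (- (real k)\<^sup>2) .. real k + exp (- (real k)\<^sup>2)}"
  let ?u = "\<lambda>k x. ennreal (b powr (real k + 1)) * indicator (?I k) x"
  have "continuous_on {0..} (\<lambda>x. b powr x * spikes x)"
    using b by (intro continuous_intros continuous_on_spikes) auto
  then show "(\<lambda>x. indicat_real {0..} x *\<^sub>R (b powr x * spikes x)) \<in> borel_measurable lborel"
    by (simp del: real_scaleR_def add: borel_measurable_continuous_on_indicator)
  have bound: "ennreal (norm (indicat_real {0..} x *\<^sub>R (b powr x * spikes x))) \<le> suminf (\<lambda>k. ?u k x)" for x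
  proof (cases "0 \<le> x \<and> spikes x \<noteq> 0")
    case True
    then obtain k :: nat where k: "\<bar>x - real k\<bar> \<le> exp (- (real k)\<^sup>2)" "x \<le> real k + 1"
      using spikes_support by blast
    have "b powr x * spikes x \<le> b powr (real k + 1) * 1"
      using b k(2) by (intro mult_mono powr_mono) (auto simp: spikes_le_1 spikes_nonneg)
    then have "ennreal (norm (indicat_real {0..} x *\<^sub>R (b powr x * spikes x))) \<le> ?u k x"
      using True k(1) by (auto simp: indicator_def abs_mult spikes_nonneg abs_le_iff intro!: ennreal_leI)
    also have "\<dots> = (\<Sum>j\<in>{k}. ?u j x)"
      by (simp only: sum.insert sum.empty finite.emptyI empty_iff not_False_eq_True add_0_right)
    also have "\<dots> \<le> suminf (\<lambda>j. ?u j x)" by (rule sum_le_suminf) auto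
    finally show ?thesis .
  qed (auto simp: indicator_def)
  have "(\<integral>\<^sup>+x. ennreal (norm (indicat_real {0..} x *\<^sub>R (b powr x * spikes x))) \<partial>lborel)
      \<le> (\<integral>\<^sup>+x. suminf (\<lambda>k. ?u k x) \<partial>lborel)"
    by (intro nn_integral_mono bound)
  also have "\<dots> = suminf (\<lambda>k. \<integral>\<^sup>+x. ?u k x \<partial>lborel)"
    by (rule nn_integral_suminf) auto
  also have "\<dots> = suminf (\<lambda>k. ennreal (b powr (real k + 1) * (2 * exp (- (real k)\<^sup>2))))"
    by (intro suminf_cong) (simp add: nn_integral_cmult_indicator ennreal_mult)
  also have "\<dots> < \<infinity>"
    using summable_spike_areas[OF b] by (simp add: ennreal_suminf_neq_top less_top)
  finally show "(\<integral>\<^sup>+x. ennreal (norm (indicat_real {0..} x *\<^sub>R (b powr x * spikes x))) \<partial>lborel) < \<infinity>" .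
qed


section \<open>Convergence to zero in the metric\<close>

text \<open>Vanishing on \<open>[0,n]\<close> forces pointwise convergence to \<open>0\<close>.\<close>

lemma L1_norm_tendsto_0:
  assumes "\<And>n. F n \<in> C_half"
    and vanish: "\<And>n x. x \<le> real n \<Longrightarrow> F n x = 0"
    and bound: "\<And>n x. 0 \<le> x \<Longrightarrow> \<bar>F n x\<bar> \<le> D x"
    and D: "set_integrable lborel {0..} D"
  shows "(\<lambda>n. L1_norm (F n)) \<longlonglongrightarrow> 0"
proof -
  have "(\<lambda>n. LINT x|lborel. indicat_real {0..} x *\<^sub>R \<bar>F n x\<bar>) \<longlonglongrightarrow> (LINT x|(lborel::real measure). 0)"
  proof (rule integral_dominated_convergence)
    show "integrable lborel (\<lambda>x. indicat_real {0..} x *\<^sub>R D x)"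
      using D by (simp add: set_integrable_def)
    show "(\<lambda>x. indicat_real {0..} x *\<^sub>R \<bar>F n x\<bar>) \<in> borel_measurable lborel" for n
    proof -
      have "continuous_on {0..} (\<lambda>x. \<bar>F n x\<bar>)"
        using assms(1)[of n] by (intro continuous_intros) (auto simp: C_half_def)
      then show ?thesis by (simp del: real_scaleR_def add: borel_measurable_continuous_on_indicator)
    qed
    show "AE x in lborel. (\<lambda>n. indicat_real {0..} x *\<^sub>R \<bar>F n x\<bar>) \<longlonglongrightarrow> 0"
    proof (rule AE_I2, rule tendsto_eventually)
      fix x :: real
      show "\<forall>\<^sub>F n in sequentially. indicat_real {0..} x *\<^sub>R \<bar>F n x\<bar> = 0"
        using eventually_ge_at_top[of "nat \<lceil>x\<rceil>"]
      proof eventually_elim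
        case (elim n)
        then have "x \<le> real n" by linarith
        then show ?case by (simp add: vanish)
      qed
    qed
    show "AE x in lborel. norm (indicat_real {0..} x *\<^sub>R \<bar>F n x\<bar>) \<le> indicat_real {0..} x *\<^sub>R D x" for n
      using bound by (auto simp: indicator_def)
  qed simp
  then show ?thesis by (simp add: L1_norm_def set_lebesgue_integral_def)
qed

text \<open>Continuity matters: the supremum of an unbounded set of reals is an arbitrary value.\<close>

lemma sup_norm_nonneg:
  assumes "f \<in> C_half"
  shows "0 \<le> sup_norm n f"
proof -
  have "continuous_on {0..real n} (\<lambda>x. \<bar>f x\<bar>)"
    using assms by (intro continuous_intros) (auto simp: C_half_def intro: continuous_on_subset)
  then have "bdd_above ((\<lambda>x. \<bar>f x\<bar>) ` {0..real n})"
    by (intro bounded_imp_bdd_above compact_imp_bounded compact_continuous_image) auto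
  then have "\<bar>f 0\<bar> \<le> sup_norm n f"
    unfolding sup_norm_def by (intro cSUP_upper) auto
  then show ?thesis by linarith
qed

text \<open>The \<open>m\<close>-th term of the series only sees \<open>[0,m+1]\<close>, so it is \<open>0\<close> from \<open>n = m + 1\<close> on, and it
  never exceeds \<open>1 / 2\<^bsup>m+1\<^esup>\<close>. Tannery's theorem then gives the limit of the series.\<close>

lemma d_X_tendsto_0:
  assumes cont: "\<And>n. F n \<in> C_half"
    and vanish: "\<And>n x. x \<le> real n \<Longrightarrow> F n x = 0"
    and bound: "\<And>n x. 0 \<le> x \<Longrightarrow> \<bar>F n x\<bar> \<le> D x"
    and D: "set_integrable lborel {0..} D"
  shows "(\<lambda>n. d_X (F n) 0) \<longlonglongrightarrow> 0"
proof -
  let ?a = "\<lambda>m n. 1 / 2 ^ Suc m * (sup_norm (Suc m) (F n) / (1 + sup_norm (Suc m) (F n)))"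
  have "(\<lambda>n. suminf (\<lambda>m. ?a m n)) \<longlonglongrightarrow> suminf (\<lambda>m. 0)"
  proof (rule tannerys_theorem[where M = "\<lambda>m. (1 / 2) ^ m", THEN conjunct2, THEN conjunct2])
    show "(\<lambda>n. ?a m n) \<longlonglongrightarrow> 0" for m
    proof (rule tendsto_eventually)
      show "\<forall>\<^sub>F n in sequentially. ?a m n = 0"
        using eventually_ge_at_top[of "Suc m"]
      proof eventually_elim
        case (elim n)
        have "sup_norm (Suc m) (F n) = (SUP x\<in>{0..real (Suc m)}. 0)"
          unfolding sup_norm_def by (intro SUP_cong) (use elim in \<open>auto simp: vanish\<close>)
        then show ?case by simp
      qed
    qed
    have "norm (?a m n) \<le> (1 / 2) ^ m" for m n
    proof -
      define s where "s = sup_norm (Suc m) (F n)"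
      have "0 \<le> s" unfolding s_def by (rule sup_norm_nonneg[OF cont])
      then have "0 \<le> s / (1 + s)" "s / (1 + s) \<le> 1" by auto
      then have "1 / 2 ^ Suc m * (s / (1 + s)) \<le> 1 / 2 ^ Suc m"
        by (intro mult_left_le) auto
      also have "\<dots> \<le> (1 / 2) ^ m" by (simp add: power_one_over field_simps)
      finally show ?thesis using \<open>0 \<le> s / (1 + s)\<close> \<open>0 \<le> s\<close> unfolding s_def by simp
    qed
    then show "\<forall>\<^sub>F (m, n) in sequentially \<times>\<^sub>F sequentially. norm (?a m n) \<le> (1 / 2) ^ m"
      by (intro always_eventually) auto
  qed auto
  with L1_norm_tendsto_0[OF cont vanish bound D]
  have "(\<lambda>n. L1_norm (F n) + suminf (\<lambda>m. ?a m n)) \<longlonglongrightarrow> 0 + suminf (\<lambda>m. 0)"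
    by (rule tendsto_add)
  then show ?thesis by (simp add: d_X_def)
qed


section \<open>A multiplicative family of sequences\<close>

definition spike_train :: "nat \<Rightarrow> real \<Rightarrow> real" where
  "spike_train n x = min 1 (max 0 (x - real n)) * spikes x"

text \<open>The size of the prime factorization is the number \<open>\<Omega>(N)\<close> of prime factors with multiplicity. As
  \<open>\<Omega>\<close> is additive, the family is multiplicative in \<open>N\<close>, and by unique factorization it lists the
  monomials in the sequences with prime index.\<close>

definition spike_power :: "nat \<Rightarrow> nat \<Rightarrow> real \<Rightarrow> real" where
  "spike_power N n x = real N powr x * spike_train n x ^ size (prime_factorization N)"

lemma spike_power_1: "spike_power 1 = 1"
  by (auto simp: fun_eq_iff spike_power_def)

lemma spike_power_mult:
  assumes "0 < N" "0 < N'"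
  shows "spike_power (N * N') = spike_power N * spike_power N'"
  using assms
  by (auto simp: fun_eq_iff spike_power_def prime_factorization_mult powr_mult power_add)

lemma spike_power_power:
  assumes "0 < N"
  shows "spike_power (N ^ e) = spike_power N ^ e"
  using assms by (induction e) (simp_all add: spike_power_1[simplified] spike_power_mult)

lemma spike_power_prod:
  assumes "\<And>i. i \<in> I \<Longrightarrow> 0 < N i"
  shows "spike_power (\<Prod>i\<in>I. N i) = (\<Prod>i\<in>I. spike_power (N i))"
  using assms
  by (induction I rule: infinite_finite_induct)
     (simp_all add: spike_power_1[simplified] spike_power_mult prod_pos)

lemma size_prime_factorization_pos:
  assumes "2 \<le> (N::nat)"
  shows "0 < size (prime_factorization N)"
proof -
  have "prime_factorization N \<noteq> {#}"
    using assms by (simp add: prime_factorization_empty_iff)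
  then show ?thesis by (simp add: nonempty_has_size)
qed

lemma spike_train_bounds: "0 \<le> spike_train n x" "spike_train n x \<le> spikes x" "spike_train n x \<le> 1"
proof -
  show "0 \<le> spike_train n x" by (simp add: spike_train_def spikes_nonneg)
  show "spike_train n x \<le> spikes x"
    unfolding spike_train_def by (intro mult_left_le_one_le) (auto simp: spikes_nonneg)
  then show "spike_train n x \<le> 1" using spikes_le_1[of x] by linarith
qed

lemma spike_train_of_nat: "n < k \<Longrightarrow> spike_train n (real k) = 1"
  by (simp add: spike_train_def spikes_of_nat)

lemma spike_power_vanish:
  assumes "2 \<le> N" "x \<le> real n"
  shows "spike_power N n x = 0"
  using assms size_prime_factorization_pos[OF assms(1)]
  by (simp add: spike_power_def spike_train_def)

text \<open>This is independent of \<open>n\<close> and of the exponent \<open>\<Omega>(N)\<close>: since \<open>\<Omega>(N) \<ge> 1\<close> and the cut-off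
  train has values in \<open>[0,1]\<close>, its powers are bounded by the full train.\<close>

lemma spike_power_bounds:
  assumes "2 \<le> N"
  shows "\<bar>spike_power N n x\<bar> \<le> real N powr x * spikes x"
proof -
  have "spike_train n x ^ size (prime_factorization N) \<le> spike_train n x ^ 1"
    using size_prime_factorization_pos[OF assms] spike_train_bounds
    by (intro power_decreasing) auto
  then have "spike_train n x ^ size (prime_factorization N) \<le> spikes x"
    using spike_train_bounds(2)[of n x] by simp
  then show ?thesis
    by (simp add: spike_power_def abs_mult spike_train_bounds mult_left_mono)
qed

lemma spike_power_of_nat:
  assumes "0 < N" "n < k"
  shows "spike_power N n (real k) = real N ^ k"
  using assms by (simp add: spike_power_def spike_train_of_nat powr_realpow)

lemma spike_power_C_half:
  assumes "2 \<le> N"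
  shows "spike_power N n \<in> C_half"
proof -
  have "continuous_on {0..} (spike_power N n)"
    unfolding spike_power_def spike_train_def using assms
    by (intro continuous_intros continuous_on_spikes) auto
  then show ?thesis using spike_power_vanish[OF assms] by (auto simp: C_half_def)
qed


section \<open>Linear combinations\<close>

lemma sum_scaleR_apply: "(\<Sum>i\<in>I. c i *\<^sub>R f i) x = (\<Sum>i\<in>I. c i *\<^sub>R f i x)"
  by (induction I rule: infinite_finite_induct) auto

text \<open>The largest base \<open>m\<close> with a nonzero coefficient dominates: after division by \<open>m\<^sup>k\<close> the sum
  converges to the coefficient of \<open>m\<close>.\<close>

lemma exponential_sum_unbounded:
  fixes c :: "nat \<Rightarrow> real"
  assumes "finite S" "S \<subseteq> {2..}" "N \<in> S" "c N \<noteq> 0"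
  shows "filterlim (\<lambda>k. \<bar>\<Sum>N\<in>S. c N * real N ^ k\<bar>) at_top sequentially"
proof -
  define T where "T = {N \<in> S. c N \<noteq> 0}"
  define m where "m = Max T"
  have T: "finite T" "T \<noteq> {}" using assms by (auto simp: T_def)
  have "m \<in> T" unfolding m_def using T by (rule Max_in)
  then have m: "2 \<le> m" "c m \<noteq> 0" using assms by (auto simp: T_def)
  have less: "N < m" if "N \<in> T - {m}" for N
    using that Max_ge[OF T(1), of N] by (auto simp: m_def less_le)
  have "(\<lambda>k. \<bar>c m + (\<Sum>N\<in>T - {m}. c N * (real N / real m) ^ k)\<bar>) \<longlonglongrightarrow> \<bar>c m + (\<Sum>N\<in>T - {m}. c N * 0)\<bar>"
    using less m by (intro tendsto_intros LIMSEQ_power_zero) auto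
  then have lim: "(\<lambda>k. \<bar>c m + (\<Sum>N\<in>T - {m}. c N * (real N / real m) ^ k)\<bar>) \<longlonglongrightarrow> \<bar>c m\<bar>"
    by simp
  have "filterlim (\<lambda>k. real m ^ k) at_top sequentially"
    using m by (subst filterlim_at_top_iff_inverse_0) (auto simp: o_def intro: LIMSEQ_inverse_realpow_zero)
  then have "filterlim (\<lambda>k. \<bar>c m + (\<Sum>N\<in>T - {m}. c N * (real N / real m) ^ k)\<bar> * real m ^ k) at_top sequentially"
    using m by (intro filterlim_tendsto_pos_mult_at_top[OF lim]) auto
  moreover have "\<bar>c m + (\<Sum>N\<in>T - {m}. c N * (real N / real m) ^ k)\<bar> * real m ^ k
      = \<bar>\<Sum>N\<in>S. c N * real N ^ k\<bar>" for k
  proof -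
    have "(\<Sum>N\<in>S. c N * real N ^ k) = (\<Sum>N\<in>T. c N * real N ^ k)"
      using assms(1) by (intro sum.mono_neutral_right) (auto simp: T_def)
    also have "\<dots> = c m * real m ^ k + (\<Sum>N\<in>T - {m}. c N * real N ^ k)"
      using T \<open>m \<in> T\<close> by (simp add: sum.remove)
    also have "\<dots> = (c m + (\<Sum>N\<in>T - {m}. c N * (real N / real m) ^ k)) * real m ^ k"
      using m by (simp add: distrib_right sum_distrib_right power_divide)
    finally show ?thesis by (simp add: abs_mult)
  qed
  ultimately show ?thesis by simp
qed

lemma Limsup_eq_infinity_if_unbounded_on_nat:
  fixes f :: "real \<Rightarrow> real"
  assumes "filterlim (\<lambda>k. \<bar>f (real k)\<bar>) at_top sequentially"
  shows "Limsup at_top (\<lambda>x. ereal \<bar>f x\<bar>) = \<infinity>"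
proof (rule ccontr)
  assume "Limsup at_top (\<lambda>x. ereal \<bar>f x\<bar>) \<noteq> \<infinity>"
  then have "Limsup at_top (\<lambda>x. ereal \<bar>f x\<bar>) < \<infinity>" by simp
  then obtain C where "Limsup at_top (\<lambda>x. ereal \<bar>f x\<bar>) < ereal C"
    using ereal_dense2 by blast
  then have "\<forall>\<^sub>F x in at_top. ereal \<bar>f x\<bar> < ereal C" by (rule Limsup_lessD)
  then have "\<forall>\<^sub>F k in sequentially. ereal \<bar>f (real k)\<bar> < ereal C"
    using filterlim_real_sequentially by (rule eventually_compose_filterlim)
  moreover have "\<forall>\<^sub>F k in sequentially. C \<le> \<bar>f (real k)\<bar>"
    using assms by (simp add: filterlim_at_top)
  ultimately have "\<forall>\<^sub>F k::nat in sequentially. False"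
    by eventually_elim simp
  then show False by simp
qed

text \<open>One nonzero coefficient suffices for every term of the sequence to be unbounded, because the
  spikes beyond \<open>n\<close> all have their full height.\<close>

lemma spike_combination_in_A_0:
  fixes c :: "nat \<Rightarrow> real"
  assumes "finite S" and S: "S \<subseteq> {2..}" and N: "N \<in> S" "c N \<noteq> 0"
  shows "(\<Sum>N\<in>S. c N *\<^sub>R spike_power N) \<in> A_0"
proof -
  define F where "F = (\<Sum>N\<in>S. c N *\<^sub>R spike_power N)"
  define D where "D = (\<lambda>x. \<Sum>N\<in>S. \<bar>c N\<bar> * (real N powr x * spikes x))"
  have F: "F n x = (\<Sum>N\<in>S. c N * spike_power N n x)" for n x
    by (simp add: F_def sum_scaleR_apply)
  have "F \<in> C_half_seq"
    unfolding F_def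
  proof (rule subspace_sum)
    show sub: "subspace C_half_seq" using subalg_C_half_seq by (simp add: subalg_def)
    show "c N *\<^sub>R spike_power N \<in> C_half_seq" if "N \<in> S" for N
      using S that by (intro subspace_scale[OF sub]) (auto simp: C_half_seq_def spike_power_C_half)
  qed
  then have cont: "F n \<in> C_half" for n by (simp add: C_half_seq_def)
  have vanish: "F n x = 0" if "x \<le> real n" for n x
    unfolding F using S that by (intro sum.neutral) (auto simp: spike_power_vanish)
  have bound: "\<bar>F n x\<bar> \<le> D x" for n x
    unfolding F D_def using S
    by (intro order.trans[OF sum_abs] sum_mono) (auto simp: abs_mult intro!: mult_left_mono spike_power_bounds)
  have D: "set_integrable lborel {0..} D"
    unfolding D_def set_integrable_def scaleR_sum_right
  proof (rule Bochner_Integration.integrable_sum)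
    fix N assume "N \<in> S"
    then have "set_integrable lborel {0..} (\<lambda>x. \<bar>c N\<bar> * (real N powr x * spikes x))"
      using S by (intro set_integrable_mult_right powr_spikes_integrable) auto
    then show "integrable lborel (\<lambda>x. indicat_real {0..} x *\<^sub>R (\<bar>c N\<bar> * (real N powr x * spikes x)))"
      by (simp add: set_integrable_def)
  qed
  have "set_integrable lborel {0..} (F n)" for n
  proof (rule set_integrable_bound[OF D])
    show "set_borel_measurable lborel {0..} (F n)"
      using cont[of n] borel_measurable_continuous_on_indicator[of "{0..}" "F n"]
      by (auto simp: C_half_def set_borel_measurable_def)
    show "AE x in lborel. x \<in> {0..} \<longrightarrow> norm (F n x) \<le> norm (D x)"
      by (intro AE_I2) (auto intro: order.trans[OF bound abs_ge_self])
  qed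
  moreover have "Limsup at_top (\<lambda>x. ereal \<bar>F n x\<bar>) = \<infinity>" for n
  proof (rule Limsup_eq_infinity_if_unbounded_on_nat)
    have "\<forall>\<^sub>F k in sequentially. \<bar>\<Sum>N\<in>S. c N * real N ^ k\<bar> = \<bar>F n (real k)\<bar>"
      using eventually_gt_at_top[of n]
    proof eventually_elim
      case (elim k)
      have "(\<Sum>N\<in>S. c N * real N ^ k) = F n (real k)"
        unfolding F using S elim by (intro sum.cong) (auto simp: spike_power_of_nat)
      then show ?case by simp
    qed
    then show "filterlim (\<lambda>k. \<bar>F n (real k)\<bar>) at_top sequentially"
      using exponential_sum_unbounded[of S N c] assms
      by (auto cong: filterlim_cong)
  qed
  ultimately have "F n \<in> A_set" for n
    using cont by (auto simp: A_set_def X_space_def)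
  then have "F \<in> A_0"
    using d_X_tendsto_0[OF cont vanish bound D] by (simp add: A_0_def)
  then show ?thesis by (simp add: F_def)
qed

lemma zero_not_in_A_0: "0 \<notin> A_0"
proof
  assume "0 \<in> A_0"
  then have "Limsup at_top (\<lambda>x::real. ereal 0) = \<infinity>"
    by (auto simp: A_0_def A_set_def)
  then show False by (simp add: Limsup_const)
qed

text \<open>The sum is indexed by \<open>N\<close>, so this also shows that distinct \<open>N\<close> give distinct sequences.\<close>

lemma spike_power_linear_independence:
  fixes c :: "nat \<Rightarrow> real"
  assumes "finite S" "S \<subseteq> {2..}" "(\<Sum>N\<in>S. c N *\<^sub>R spike_power N) = 0" "N \<in> S"
  shows "c N = 0"
  using spike_combination_in_A_0[of S N c] assms zero_not_in_A_0 by auto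

lemma inj_on_spike_power: "inj_on spike_power {2..}"
proof (rule inj_onI, rule ccontr)
  fix N N' assume *: "N \<in> {2..}" "N' \<in> {2..}" "spike_power N = spike_power N'" "N \<noteq> N'"
  then have "(\<Sum>K\<in>{N, N'}. (if K = N then 1 else -1 :: real) *\<^sub>R spike_power K) = 0"
    by simp
  from spike_power_linear_independence[OF _ _ this, of N] * show False by auto
qed

lemma span_spike_power_cases:
  assumes "F \<in> span (spike_power ` I)" "I \<subseteq> {2..}"
  obtains S c where "finite S" "S \<subseteq> I" "F = (\<Sum>N\<in>S. c N *\<^sub>R spike_power N)"
proof -
  from assms(1) obtain t r where t: "finite t" "t \<subseteq> spike_power ` I" "F = (\<Sum>a\<in>t. r a *\<^sub>R a)"
    unfolding span_explicit by blast
  from finite_subset_image[OF t(1,2)] obtain S where S: "S \<subseteq> I" "finite S" "t = spike_power ` S"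
    by auto
  have "inj_on spike_power S"
    using inj_on_spike_power S assms(2) by (blast intro: inj_on_subset)
  then have "F = (\<Sum>N\<in>S. r (spike_power N) *\<^sub>R spike_power N)"
    using t(3) S(3) by (simp add: sum.reindex)
  with S show ?thesis by (intro that[of S "\<lambda>N. r (spike_power N)"]) auto
qed

lemma independent_spike_power: "independent (spike_power ` {2..})"
  unfolding independent_explicit_finite_subsets
proof (intro allI impI)
  fix t u
  assume t: "t \<subseteq> spike_power ` {2..}" "finite t" "(\<Sum>v\<in>t. u v *\<^sub>R v) = 0"
  from finite_subset_image[OF t(2,1)] obtain S where S: "S \<subseteq> {2..}" "finite S" "t = spike_power ` S"
    by auto
  then have "inj_on spike_power S"
    using inj_on_spike_power by (blast intro: inj_on_subset)
  moreover define c where "c N = u (spike_power N)" for N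
  ultimately have "(\<Sum>N\<in>S. c N *\<^sub>R spike_power N) = 0"
    using t(3) S(3) by (simp add: sum.reindex)
  note c_0 = spike_power_linear_independence[OF S(2,1) this]
  show "\<forall>v\<in>t. u v = 0"
    unfolding S(3) using c_0 by (simp add: c_def)
qed


section \<open>The algebra spanned by the family\<close>

lemma subalg_span_spike_power:
  assumes "I \<subseteq> {2..}" "\<And>N N'. N \<in> I \<Longrightarrow> N' \<in> I \<Longrightarrow> N * N' \<in> I"
  shows "subalg (span (spike_power ` I))"
  unfolding subalg_def
proof (intro conjI ballI)
  let ?V = "span (spike_power ` I)"
  have gen: "spike_power N * G \<in> ?V" if "N \<in> I" "G \<in> ?V" for N G
    using that(2)
  proof (induction rule: span_induct_alt)
    case base
    show ?case by (simp only: mult_zero_left mult_zero_right span_zero)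
  next
    case (step c x y)
    then obtain N' where N': "N' \<in> I" "x = spike_power N'" by auto
    have "spike_power (N * N') = spike_power N * spike_power N'"
      using \<open>N \<in> I\<close> N' assms(1) by (intro spike_power_mult) auto
    moreover have "spike_power (N * N') \<in> ?V"
      using \<open>N \<in> I\<close> N' assms(2) by (intro span_base) auto
    ultimately show ?case
      using step N' by (simp only: distrib_left mult_scaleR_right span_add span_scale)
  qed
  fix F G assume "F \<in> ?V" "G \<in> ?V"
  from this(1) show "F * G \<in> ?V"
  proof (induction rule: span_induct_alt)
    case base
    show ?case by (simp only: mult_zero_left mult_zero_right span_zero)
  next
    case (step c x y)
    then show ?case
      using gen[OF _ \<open>G \<in> ?V\<close>] by (auto simp only: distrib_right mult_scaleR_left intro!: span_add span_scale)
  qed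
qed (rule subspace_span)

definition spike_algebra :: "(nat \<Rightarrow> real \<Rightarrow> real) set" where
  "spike_algebra = span (spike_power ` {2..})"

lemma subalg_spike_algebra: "subalg spike_algebra"
  unfolding spike_algebra_def
proof (rule subalg_span_spike_power)
  fix N N' :: nat assume "N \<in> {2..}" "N' \<in> {2..}"
  then have "2 * 1 \<le> N * N'" by (intro mult_le_mono) auto
  then show "N * N' \<in> {2..}" by simp
qed simp

lemma spike_algebra_subset_A_0: "spike_algebra - {0} \<subseteq> A_0"
proof
  fix F assume F: "F \<in> spike_algebra - {0}"
  then obtain S c where S: "finite S" "S \<subseteq> {2..}" "F = (\<Sum>N\<in>S. c N *\<^sub>R spike_power N)"
    unfolding spike_algebra_def by (blast elim: span_spike_power_cases)
  have "\<exists>N\<in>S. c N \<noteq> 0"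
  proof (rule ccontr)
    assume "\<not> (\<exists>N\<in>S. c N \<noteq> 0)"
    then have "F = 0" unfolding S(3) by (intro sum.neutral) auto
    with F show False by blast
  qed
  with S show "F \<in> A_0" using spike_combination_in_A_0 by blast
qed

text \<open>By induction over the prime factorization every member of the family is a product of members
  with prime index.\<close>

lemma hull_primes: "subalg hull (spike_power ` {p. prime p}) = spike_algebra"
proof
  have "spike_power ` {p. prime p} \<subseteq> spike_algebra"
    unfolding spike_algebra_def by (auto intro!: span_base imageI dest: prime_ge_2_nat)
  then show "subalg hull (spike_power ` {p. prime p}) \<subseteq> spike_algebra"
    using subalg_spike_algebra by (rule hull_minimal)
next
  let ?H = "subalg hull (spike_power ` {p. prime p})"
  have sub: "subalg ?H" by (rule subalg_hull)
  have "2 \<le> N \<longrightarrow> spike_power N \<in> ?H" for N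
  proof (induction N rule: prime_divisors_induct)
    case (factor p x)
    have p: "spike_power p \<in> ?H" using factor(1) by (auto intro: hull_inc)
    show ?case
    proof
      assume le: "2 \<le> p * x"
      show "spike_power (p * x) \<in> ?H"
      proof (cases "x = 1")
        case False
        with le have "2 \<le> x" by (cases x) auto
        with factor(2) have "spike_power x \<in> ?H" by blast
        with p sub have "spike_power p * spike_power x \<in> ?H" unfolding subalg_def by blast
        then show ?thesis using \<open>2 \<le> x\<close> factor(1) by (simp add: spike_power_mult prime_gt_0_nat)
      qed (use p in simp)
    qed
  qed auto
  then show "spike_algebra \<subseteq> ?H"
    unfolding spike_algebra_def using sub by (intro span_minimal) (auto simp: subalg_def)
qed

text \<open>A finite set involves only finitely many primes \<open>Q\<close>. The span over the indices composed of
  primes in \<open>Q\<close> is a subalgebra, and by linear independence it misses the generator of any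
  other prime.\<close>

lemma infinitely_generated_spike_algebra: "infinitely_generated spike_algebra"
  unfolding infinitely_generated_def
proof (intro allI impI notI)
  fix G assume hull: "subalg hull G = spike_algebra" and "finite G"
  have "\<forall>F\<in>G. \<exists>S. finite S \<and> S \<subseteq> {2..} \<and> F \<in> span (spike_power ` S)"
  proof
    fix F assume "F \<in> G"
    then have "F \<in> span (spike_power ` {2..})"
      unfolding spike_algebra_def[symmetric] hull[symmetric] by (rule hull_inc)
    then obtain S c where S: "finite S" "S \<subseteq> {2..}" "F = (\<Sum>N\<in>S. c N *\<^sub>R spike_power N)"
      by (rule span_spike_power_cases) simp
    have "F \<in> span (spike_power ` S)"
      unfolding S(3) by (intro span_sum span_scale span_base imageI)
    with S(1,2) show "\<exists>S. finite S \<and> S \<subseteq> {2..} \<and> F \<in> span (spike_power ` S)"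
      by (intro exI conjI)
  qed
  from bchoice[OF this] obtain S
    where "\<forall>F\<in>G. finite (S F) \<and> S F \<subseteq> {2..} \<and> F \<in> span (spike_power ` S F)" ..
  then have S: "finite (S F)" "S F \<subseteq> {2..}" "F \<in> span (spike_power ` S F)" if "F \<in> G" for F
    using that by simp_all
  define Q where "Q = (\<Union>F\<in>G. \<Union>N\<in>S F. prime_factors N)"
  have "finite Q" unfolding Q_def using \<open>finite G\<close> S(1) by auto
  then obtain p where p: "prime p" "p \<notin> Q"
    using primes_infinite by (metis finite_subset mem_Collect_eq subsetI)
  define I where "I = {N::nat. 2 \<le> N \<and> prime_factors N \<subseteq> Q}"
  have "subalg (span (spike_power ` I))"
  proof (rule subalg_span_spike_power)
    fix N N' assume *: "N \<in> I" "N' \<in> I"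
    then have "2 * 1 \<le> N * N'" by (intro mult_le_mono) (auto simp: I_def)
    with * show "N * N' \<in> I" by (auto simp: I_def prime_factors_product)
  qed (auto simp: I_def)
  moreover have "G \<subseteq> span (spike_power ` I)"
  proof
    fix F assume F: "F \<in> G"
    then have "S F \<subseteq> I" using S(2) by (auto simp: I_def Q_def)
    then have "span (spike_power ` S F) \<subseteq> span (spike_power ` I)" by (intro span_mono image_mono)
    then show "F \<in> span (spike_power ` I)" using S(3)[OF F] by (rule subsetD)
  qed
  ultimately have "spike_algebra \<subseteq> span (spike_power ` I)"
    unfolding hull[symmetric] by (intro hull_minimal)
  moreover have p2: "p \<in> {2..}" using p(1) by (simp add: prime_ge_2_nat)
  then have "spike_power p \<in> spike_algebra"
    unfolding spike_algebra_def by (intro span_base imageI)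
  moreover have "p \<notin> I" using p by (auto simp: I_def prime_prime_factors)
  then have "spike_power ` I \<subseteq> spike_power ` {2..} - {spike_power p}"
    using inj_on_spike_power p2 by (auto simp: I_def inj_on_def)
  ultimately have "spike_power p \<in> span (spike_power ` {2..} - {spike_power p})"
    using span_mono by blast
  then show False
    using independent_spike_power p2 unfolding dependent_def by blast
qed

text \<open>Unique factorization: the exponent of the \<open>j\<close>-th variable is recovered as the multiplicity of the
  \<open>j\<close>-th prime.\<close>

lemma inj_on_prime_monomials:
  fixes p :: "nat \<Rightarrow> nat"
  assumes p: "\<And>i. i < s \<Longrightarrow> prime (p i)" and inj: "inj_on p {..<s}"
  shows "inj_on (\<lambda>m. \<Prod>i\<in>Poly_Mapping.keys m. p i ^ Poly_Mapping.lookup m i)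
    {m. Poly_Mapping.keys m \<subseteq> {..<s}}"
proof -
  have mult: "multiplicity (p j) (\<Prod>i\<in>Poly_Mapping.keys m. p i ^ Poly_Mapping.lookup m i)
      = Poly_Mapping.lookup m j"
    if m: "Poly_Mapping.keys m \<subseteq> {..<s}" and j: "j < s" for m :: "nat \<Rightarrow>\<^sub>0 nat" and j
  proof -
    define q where "q = the_inv_into {..<s} p"
    have q: "q (p i) = i" if "i < s" for i
      unfolding q_def using inj that by (simp add: the_inv_into_f_f)
    have "(\<Prod>i\<in>Poly_Mapping.keys m. p i ^ Poly_Mapping.lookup m i)
        = (\<Prod>i<s. p i ^ Poly_Mapping.lookup m i)"
      using m by (intro prod.mono_neutral_left) (auto simp: in_keys_iff)
    also have "\<dots> = (\<Prod>x\<in>p ` {..<s}. x ^ Poly_Mapping.lookup m (q x))"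
      by (subst prod.reindex[OF inj]) (auto simp: q intro!: prod.cong)
    also have "multiplicity (p j) \<dots> = Poly_Mapping.lookup m j"
      using p j by (subst multiplicity_prod_prime_powers) (auto simp: q)
    finally show ?thesis .
  qed
  show ?thesis
  proof (rule inj_onI, rule poly_mapping_eqI)
    fix m m' :: "nat \<Rightarrow>\<^sub>0 nat" and j
    assume *: "m \<in> {m. Poly_Mapping.keys m \<subseteq> {..<s}}" "m' \<in> {m. Poly_Mapping.keys m \<subseteq> {..<s}}"
      "(\<Prod>i\<in>Poly_Mapping.keys m. p i ^ Poly_Mapping.lookup m i)
        = (\<Prod>i\<in>Poly_Mapping.keys m'. p i ^ Poly_Mapping.lookup m' i)"
    show "Poly_Mapping.lookup m j = Poly_Mapping.lookup m' j"
    proof (cases "j < s")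
      case True
      then show ?thesis using * mult[of m j] mult[of m' j] by simp
    next
      case False
      then have "j \<notin> Poly_Mapping.keys m" "j \<notin> Poly_Mapping.keys m'" using * by auto
      then show ?thesis by (simp add: in_keys_iff)
    qed
  qed
qed

text \<open>Substituting generators into a polynomial turns the monomial \<open>m\<close> into the member of the family
  with index \<open>\<nu> m\<close>. These indices are distinct, and at least \<open>2\<close> because the constant term is
  excluded. So the value is a linear combination of independent sequences, with the
  coefficients of the polynomial.\<close>

lemma free_generators_spike_algebra:
  "free_generators (spike_power ` {p. prime p}) spike_algebra"
  unfolding free_generators_def
proof (intro conjI allI impI hull_primes)
  fix s P and f :: "nat \<Rightarrow> nat \<Rightarrow> real \<Rightarrow> real"
  assume P: "P \<noteq> 0" "in_vars s P" "no_const_term P"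
    and f: "inj_on f {..<s}" "f ` {..<s} \<subseteq> spike_power ` {p. prime p}"
  from f(2) have "\<forall>i\<in>{..<s}. \<exists>p. prime p \<and> f i = spike_power p" by blast
  then obtain p where p: "\<And>i. i < s \<Longrightarrow> prime (p i)" "\<And>i. i < s \<Longrightarrow> f i = spike_power (p i)"
    by (metis lessThan_iff)
  have inj_p: "inj_on p {..<s}"
    using f(1) p(2) by (auto simp: inj_on_def)
  define K where "K = Poly_Mapping.keys P"
  define \<nu> where "\<nu> m = (\<Prod>i\<in>Poly_Mapping.keys m. p i ^ Poly_Mapping.lookup m i)" for m
  have K: "Poly_Mapping.keys m \<subseteq> {..<s}" if "m \<in> K" for m
    using that P(2) by (auto simp: in_vars_def K_def)
  have inj: "inj_on \<nu> {m. Poly_Mapping.keys m \<subseteq> {..<s}}"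
    unfolding \<nu>_def using p(1) inj_p by (rule inj_on_prime_monomials)
  have inj_K: "inj_on \<nu> K" using inj by (rule inj_on_subset) (use K in auto)
  have \<nu>_ge_2: "2 \<le> \<nu> m" if "m \<in> K" for m
  proof -
    have "m \<noteq> 0" using that P(3) by (auto simp: K_def no_const_term_def in_keys_iff)
    then have "\<nu> m \<noteq> \<nu> 0" using inj K[OF that] by (auto simp: inj_on_def)
    moreover have "0 < \<nu> m"
      unfolding \<nu>_def using p(1) K[OF that] by (intro prod_pos) (auto simp: prime_gt_0_nat)
    moreover have "\<nu> 0 = 1" by (simp add: \<nu>_def)
    ultimately show ?thesis by linarith
  qed
  have "(\<Prod>i\<in>Poly_Mapping.keys m. f i ^ Poly_Mapping.lookup m i) = spike_power (\<nu> m)" if "m \<in> K" for m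
  proof -
    have "spike_power (\<nu> m) = (\<Prod>i\<in>Poly_Mapping.keys m. spike_power (p i ^ Poly_Mapping.lookup m i))"
      unfolding \<nu>_def using p(1) K[OF that] by (intro spike_power_prod) (auto simp: prime_gt_0_nat)
    also have "\<dots> = (\<Prod>i\<in>Poly_Mapping.keys m. f i ^ Poly_Mapping.lookup m i)"
      using p K[OF that] by (intro prod.cong) (auto simp: spike_power_power prime_gt_0_nat subset_eq)
    finally show ?thesis ..
  qed
  then have "poly_eval P f = (\<Sum>m\<in>K. Poly_Mapping.lookup P m *\<^sub>R spike_power (\<nu> m))"
    by (simp add: poly_eval_def K_def)
  also have "\<dots> = (\<Sum>N\<in>\<nu> ` K. Poly_Mapping.lookup P (the_inv_into K \<nu> N) *\<^sub>R spike_power N)"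
    by (simp add: sum.reindex[OF inj_K] the_inv_into_f_f[OF inj_K])
  finally have eval: "poly_eval P f = \<dots>" .
  obtain m where m: "m \<in> K" using P(1) unfolding K_def by (metis keys_eq_empty ex_in_conv)
  show "poly_eval P f \<noteq> 0"
  proof
    assume "poly_eval P f = 0"
    with eval have "Poly_Mapping.lookup P (the_inv_into K \<nu> (\<nu> m)) = 0"
      using m \<nu>_ge_2
      by (intro spike_power_linear_independence[of "\<nu> ` K" "\<lambda>N. Poly_Mapping.lookup P (the_inv_into K \<nu> N)"])
         (auto simp: K_def)
    with m show False by (simp add: the_inv_into_f_f[OF inj_K]) (simp add: K_def in_keys_iff)
  qed
qed

theorem theorem3p3:
  shows "strongly_algebrable_in C_half_seq A_0"
  unfolding strongly_algebrable_in_def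
proof (intro exI conjI)
  show "spike_algebra \<subseteq> C_half_seq"
    unfolding spike_algebra_def using subalg_C_half_seq
    by (intro span_minimal) (auto simp: subalg_def C_half_seq_def spike_power_C_half)
  show "free_subalg spike_algebra"
    unfolding free_subalg_def using free_generators_spike_algebra by blast
qed (rule subalg_spike_algebra infinitely_generated_spike_algebra spike_algebra_subset_A_0)+

end
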